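(* Let $f:(0,\infty)\to(0,\infty)$ be monotone increasing, let $x_0>0$, and suppose that the series $\sum_{n=1}^{\infty} f^n(x_0)$ is convergent. If $g$ is a real-valued function on $(0,\infty)$ with $0<g(x)\leq f(x)<x$ for all $x>0$, then the series $\sum_{n=1}^{\infty} g^n(x_0)$ converges as well.
   Context: For a function $h$, $h^n$ denotes the $n$-fold composition $h\circ h\circ\cdots\circ h$ ($n$ times), with $h^0=\operatorname{Id}$; it does not denote a power of the value of $h$. *)

theory Defs
  imports Complex_Main
begin

end

theory Submission
  imports Defs
begin

text \<open>
  The orbit of \<open>g\<close> is dominated termwise by the orbit of \<open>f\<close>, so the comparison test applies.
  To pass from terms \<open>a \<le> b\<close> of the two orbits to the next ones, split the estimate as
  \<open>g a \<le> f a \<le> f b\<close>: the functions are compared at the common point \<open>a\<close>, and only the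
  increasing function \<open>f\<close> is evaluated at two different points.
\<close>

lemma funpow_pos_le_of_mono_majorant:
  fixes f g :: "'a :: {preorder, zero} \<Rightarrow> 'a"
  assumes mono: "mono_on {0<..} f"
    and bounds: "\<And>x. x > 0 \<Longrightarrow> 0 < g x \<and> g x \<le> f x"
    and "x0 > 0"
  shows "0 < (g ^^ n) x0 \<and> (g ^^ n) x0 \<le> (f ^^ n) x0"
proof (induction n)
  case 0
  show ?case using \<open>x0 > 0\<close> by simp
next
  case (Suc n)
  let ?a = "(g ^^ n) x0" and ?b = "(f ^^ n) x0"
  have "0 < ?a" "?a \<le> ?b" using Suc.IH by auto
  then have "0 < ?b" by (rule less_le_trans)
  have "g ?a \<le> f ?a" using bounds \<open>0 < ?a\<close> by blast
  also have "f ?a \<le> f ?b"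
    using \<open>0 < ?a\<close> \<open>0 < ?b\<close> \<open>?a \<le> ?b\<close> by (intro mono_onD[OF mono]) auto
  finally show ?case using bounds \<open>0 < ?a\<close> by simp
qed

theorem theorem3p1:
  fixes f g :: "real \<Rightarrow> real" and x0 :: real
  assumes "\<And>x. x > 0 \<Longrightarrow> f x > 0"
    and "mono_on {0<..} f"
    and "x0 > 0"
    and "summable (\<lambda>n. (f ^^ Suc n) x0)"
    and "\<And>x. x > 0 \<Longrightarrow> 0 < g x \<and> g x \<le> f x \<and> f x < x"
  shows "summable (\<lambda>n. (g ^^ Suc n) x0)"
proof (rule summable_comparison_test'[OF assms(4)])
  fix n :: nat
  have "0 < (g ^^ Suc n) x0 \<and> (g ^^ Suc n) x0 \<le> (f ^^ Suc n) x0"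
    using assms(2,3,5) by (intro funpow_pos_le_of_mono_majorant) auto
  then show "norm ((g ^^ Suc n) x0) \<le> (f ^^ Suc n) x0"
    unfolding real_norm_def by linarith
qed

end
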